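(* Let $G=(V,D)$ be a directed graph and let $A,B\subseteq V$ be subsets of the same cardinality $k$, both with fixed linear orderings. If two self-avoiding trek flows $\mathbf{T}$ and $\mathbf{T}'$ from $A$ to $B$ satisfy $m_{\mathbf{T}}=m_{\mathbf{T}'}$, then $\mathrm{sign}(\mathbf{T})=\mathrm{sign}(\mathbf{T}')$.
   Context: $G=(V,D)$ is a finite directed graph (possibly with directed cycles) without loops or multiple edges; edges $i\to j$ carry indeterminates $\lambda_{ij}$ and vertices $i$ indeterminates $\omega_{ii}$. A self-avoiding path visits each vertex at most once (empty paths at a vertex allowed); a self-avoiding cycle is a nonempty directed cycle visiting each vertex at most once, identified with its edge set. For $k$-subsets $X=\{x_1,\dots,x_k\}$, $Y=\{y_1,\dots,y_k\}$ with these orderings, a self-avoiding flow from $X$ to $Y$ is a pair $\mathbf{F}=(\mathbf{P},\mathbf{C})$ where $\mathbf{P}$ is a set of $k$ self-avoiding pairwise vertex-disjoint paths whose initial vertices exhaust $X$ and final vertices exhaust $Y$, and $\mathbf{C}$ is a set of self-avoiding cycles, pairwise vertex-disjoint and vertex-disjoint from all paths in $\mathbf{P}$. If the path from $x_i$ ends at $y_{\pi(i)}$, then $\mathrm{sign}(\mathbf{F})=\mathrm{sign}(\pi)(-1)^{|\mathbf{C}|}$. A self-avoiding trek flow from $A$ to $B$ is a pair $\mathbf{T}=(\mathbf{F}_L,\mathbf{F}_R)$ where, for some $k$-subset $S\subseteq V$ (the tops), $\mathbf{F}_L$ is a self-avoiding flow from $S$ to $A$ and $\mathbf{F}_R$ a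 self-avoiding flow from $S$ to $B$. Its sign is $\mathrm{sign}(\mathbf{T})=\mathrm{sign}(\mathbf{F}_R)\mathrm{sign}(\mathbf{F}_L)$, computed with the given orderings of $A,B$ and any one linear ordering of $S$ used for both flows. Its monomial $m_{\mathbf{T}}$ is the product of $\omega_{ii}$ over $i\in S$ and of $\lambda_{ij}$ over all edges $i\to j$ used by paths and cycles of $\mathbf{F}_L$ and of $\mathbf{F}_R$, with multiplicity. *)

theory Defs
  imports
    "HOL-Library.Poly_Mapping"
    "HOL-Combinatorics.Permutations"
    "HOL-Combinatorics.Multiset_Permutations"
    "Graph_Theory.Pair_Digraph"
    "Graph_Theory.Vertex_Walk"
begin

text \<open>
  A pair \<open>(P, C)\<close>. A path is the list of its vertices, so that the empty path at \<open>v\<close> is \<open>[v]\<close>;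
  a cycle is its set of edges.
\<close>
type_synonym 'v flow = "'v list set \<times> ('v \<times> 'v) set set"

type_synonym 'v trek_flow = "'v flow \<times> 'v flow"

definition self_avoiding_path :: "'v pair_pre_digraph \<Rightarrow> 'v list \<Rightarrow> bool" where
  "self_avoiding_path G p \<longleftrightarrow> vpath p (with_proj G)"

definition self_avoiding_cycle :: "'v pair_pre_digraph \<Rightarrow> ('v \<times> 'v) set \<Rightarrow> bool" where
  "self_avoiding_cycle G c \<longleftrightarrow> (\<exists>es. pre_digraph.cycle (with_proj G) es \<and> c = set es)"

text \<open>For a cycle \<open>c\<close>, \<open>Field c\<close> is its set of vertices.\<close>
definition self_avoiding_flow ::
    "'v pair_pre_digraph \<Rightarrow> 'v set \<Rightarrow> 'v set \<Rightarrow> 'v flow \<Rightarrow> bool" where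
  "self_avoiding_flow G X Y F \<longleftrightarrow> (case F of (P, C) \<Rightarrow>
     X \<subseteq> pverts G \<and> Y \<subseteq> pverts G \<and> card X = card Y \<and>
     finite P \<and> card P = card X \<and>
     (\<forall>p\<in>P. self_avoiding_path G p) \<and>
     pairwise (\<lambda>p q. disjnt (set p) (set q)) P \<and>
     hd ` P = X \<and> last ` P = Y \<and>
     (\<forall>c\<in>C. self_avoiding_cycle G c) \<and>
     pairwise (\<lambda>c d. disjnt (Field c) (Field d)) C \<and>
     (\<forall>p\<in>P. \<forall>c\<in>C. disjnt (set p) (Field c)))"

text \<open>
  Linear orderings of \<open>X\<close> and \<open>Y\<close> are given as lists \<open>xs\<close> and \<open>ys\<close>, indexed from \<open>0\<close>;
  \<open>i\<close> is mapped to the \<open>j\<close> such that the path from \<open>xs ! i\<close> ends at \<open>ys ! j\<close>, and the map is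
  extended by the identity to a permutation of the natural numbers.
\<close>
definition flow_perm :: "'v list \<Rightarrow> 'v list \<Rightarrow> 'v flow \<Rightarrow> nat \<Rightarrow> nat" where
  "flow_perm xs ys F i =
     (if i < length xs
      then THE j. j < length ys \<and> (\<exists>p \<in> fst F. hd p = xs ! i \<and> last p = ys ! j)
      else i)"

definition flow_sign :: "'v list \<Rightarrow> 'v list \<Rightarrow> 'v flow \<Rightarrow> int" where
  "flow_sign xs ys F = sign (flow_perm xs ys F) * (-1) ^ card (snd F)"

definition self_avoiding_trek_flow ::
    "'v pair_pre_digraph \<Rightarrow> 'v set \<Rightarrow> 'v set \<Rightarrow> 'v trek_flow \<Rightarrow> bool" where
  "self_avoiding_trek_flow G A B T \<longleftrightarrow> (case T of (FL, FR) \<Rightarrow>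
     (\<exists>S \<subseteq> pverts G. card S = card A \<and> self_avoiding_flow G S A FL \<and> self_avoiding_flow G S B FR))"

text \<open>
  The set \<open>S\<close> above is determined by the trek flow: it consists of the initial vertices of the
  paths of the left (equivalently, right) flow.
\<close>
definition trek_tops :: "'v trek_flow \<Rightarrow> 'v set" where
  "trek_tops T = hd ` fst (fst T)"

text \<open>The list \<open>ss\<close> is a linear ordering of the tops, the same for both flows.\<close>
definition trek_sign :: "'v list \<Rightarrow> 'v list \<Rightarrow> 'v list \<Rightarrow> 'v trek_flow \<Rightarrow> int" where
  "trek_sign ss as bs T = flow_sign ss bs (snd T) * flow_sign ss as (fst T)"

datatype 'v indet = Omega 'v | Lambda 'v 'v

text \<open>
  The ring of polynomials in these indeterminates with integer coefficients: an element maps each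
  exponent vector to its coefficient.
\<close>
type_synonym 'v trek_poly = "('v indet \<Rightarrow>\<^sub>0 nat) \<Rightarrow>\<^sub>0 int"

definition indet_poly :: "'v indet \<Rightarrow> 'v trek_poly" where
  "indet_poly x = Poly_Mapping.single (Poly_Mapping.single x 1) 1"

definition edge_poly :: "'v \<times> 'v \<Rightarrow> 'v trek_poly" where
  "edge_poly e = indet_poly (Lambda (fst e) (snd e))"

definition flow_monomial :: "'v flow \<Rightarrow> 'v trek_poly" where
  "flow_monomial F =
     (\<Prod>p\<in>fst F. \<Prod>e\<leftarrow>vwalk_arcs p. edge_poly e) * (\<Prod>c\<in>snd F. \<Prod>e\<in>c. edge_poly e)"

definition trek_monomial :: "'v trek_flow \<Rightarrow> 'v trek_poly" where
  "trek_monomial T =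
     (\<Prod>i\<in>trek_tops T. indet_poly (Omega i)) * flow_monomial (fst T) * flow_monomial (snd T)"

end

theory Submission
  imports Defs "HOL-Combinatorics.Cycles"
begin

text \<open>
  Let \<open>E\<close> be the set of arcs of a flow from \<open>S\<close> to \<open>A\<close>. Sending each arc's tail to its head, the
  \<open>i\<close>-th element of \<open>A\<close> to the \<open>i\<close>-th element of \<open>S\<close>, and fixing all vertices off the flow gives a
  permutation of \<open>V\<close> whose sign is \<open>(-1)\<^bsup>|E|\<^esup>\<close> times the sign of the flow. Let \<open>p\<^sub>L\<close> and \<open>p\<^sub>R\<close> be the
  inverses of these permutations for the two flows of a trek flow. Since there are no loops, the
  monomial determines \<open>S\<close> and, for each vertex \<open>w\<close>, the unordered pair of \<open>p\<^sub>L w\<close> and \<open>p\<^sub>R w\<close>: outside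
  \<open>S\<close> its members are the two predecessors of \<open>w\<close>, with \<open>w\<close> itself standing in for a missing one,
  and on \<open>S\<close> they are given by the orderings of \<open>S\<close>, \<open>A\<close> and \<open>B\<close>. So two trek flows with the
  same monomial differ by switching \<open>p\<^sub>L w\<close> and \<open>p\<^sub>R w\<close> for some \<open>w\<close>, and if such a switch leads to
  permutations again, it does not change the product of the signs.
\<close>

section \<open>Signs of permutations\<close>

text \<open>Each unfolding of \<open>cycle_of_list\<close> splits off one transposition, and there
  are \<open>length cs - 1\<close> unfoldings.\<close>

lemma sign_cycle_of_list:
  assumes "distinct cs" and "cs \<noteq> []"
  shows "sign (cycle_of_list cs) = (-1) ^ (length cs - 1)"
  using assms
  by (induction cs rule: cycle_of_list.induct)
     (auto simp: sign_compose permutation_swap_id permutation_of_cycle sign_swap_id)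

text \<open>Serves to glue the cyclic permutations of all paths, or of all cycles, of a flow. In a
  composition of permutations with disjoint supports each factor acts alone on its own set, and
  signs multiply.\<close>

lemma permutation_of_disjoint_family:
  assumes "finite I" and "\<And>i. i \<in> I \<Longrightarrow> finite (U i)"
    and "\<And>i. i \<in> I \<Longrightarrow> g i permutes U i"
    and "pairwise (\<lambda>i j. disjnt (U i) (U j)) I"
  obtains h where "h permutes (\<Union>i\<in>I. U i)"
    and "\<And>i x. i \<in> I \<Longrightarrow> x \<in> U i \<Longrightarrow> h x = g i x"
    and "sign h = (\<Prod>i\<in>I. sign (g i))"
proof -
  have "\<exists>h. h permutes (\<Union>i\<in>I. U i) \<and> (\<forall>i\<in>I. \<forall>x\<in>U i. h x = g i x)
      \<and> sign h = (\<Prod>i\<in>I. sign (g i))"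
    using assms
  proof (induction I rule: finite_induct)
    case empty
    show ?case by (rule exI[of _ id]) auto
  next
    case (insert i I)
    obtain h where h: "h permutes (\<Union>i\<in>I. U i)" "\<forall>i\<in>I. \<forall>x\<in>U i. h x = g i x"
        "sign h = (\<Prod>i\<in>I. sign (g i))"
      using insert by (auto simp: pairwise_insert)
    have gi: "g i permutes U i" using insert by auto
    have disj: "U i \<inter> (\<Union>j\<in>I. U j) = {}"
      using insert.hyps insert.prems(3) by (fastforce simp: pairwise_insert disjnt_def)
    have "(h \<circ> g i) permutes (\<Union>j\<in>insert i I. U j)"
      by (intro permutes_compose permutes_subset[OF gi] permutes_subset[OF h(1)]) auto
    moreover have "(h \<circ> g i) x = g j x" if "j \<in> insert i I" "x \<in> U j" for j x
    proof (cases "j = i")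
      case True
      then have "g i x \<in> U i" using that permutes_in_image[OF gi] by auto
      then have "h (g i x) = g i x" using disj permutes_not_in[OF h(1)] by blast
      then show ?thesis using True by simp
    next
      case False
      then have "x \<notin> U i" using that disj by blast
      then show ?thesis using False that h(2) permutes_not_in[OF gi] by auto
    qed
    moreover have "sign (h \<circ> g i) = (\<Prod>j\<in>insert i I. sign (g j))"
    proof -
      have "permutation h" using permutes_imp_permutation[OF _ h(1)] insert by blast
      moreover have "permutation (g i)" using permutes_imp_permutation[OF _ gi] insert by blast
      ultimately show ?thesis
        using insert.hyps h(3) by (simp add: sign_compose mult.commute)
    qed
    ultimately show ?case by blast
  qed
  then show thesis using that by blast
qed

text \<open>
  On the set where \<open>p'\<close> has been switched from \<open>p\<close> to \<open>q\<close>, the permutation \<open>p\<inverse> q\<close> restricts to a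
  permutation \<open>r\<close>, so that \<open>p' = p r\<close> and \<open>q' = q r\<inverse>\<close>.
\<close>
lemma sign_mult_eq_of_switch:
  assumes "finite V" and p: "p permutes V" and q: "q permutes V"
    and p': "p' permutes V" and q': "q' permutes V"
    and switch: "\<And>w. (p' w = p w \<and> q' w = q w) \<or> (p' w = q w \<and> q' w = p w)"
  shows "sign p' * sign q' = sign p * sign q"
proof -
  define r where "r = inv p \<circ> p'"
  have r: "r permutes V" unfolding r_def by (intro permutes_compose permutes_inv p p')
  have perm: "permutation f" if "f permutes V" for f
    using that \<open>finite V\<close> by (rule permutes_imp_permutation[rotated])
  have p'_eq: "p' = p \<circ> r" by (simp add: r_def fun_eq_iff permutes_inverses[OF p])
  have q_eq: "q = q' \<circ> r"
  proof
    fix w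
    have pr: "p (r w) = p' w" by (simp add: p'_eq)
    show "q w = (q' \<circ> r) w"
    proof (cases "p' w = p w")
      case True
      then have "r w = w" using pr permutes_inj[OF p] by (simp add: inj_eq)
      then show ?thesis using switch[of w] True by auto
    next
      case False
      then have w: "p' w = q w" using switch[of w] by auto
      \<comment> \<open>Switched points stay switched under \<open>r\<close>: agreement of
        \<open>p'\<close> and \<open>p\<close> at \<open>r w\<close> would give
        \<open>r w = w\<close> by injectivity of \<open>p'\<close>, and then agreement at
        \<open>w\<close>.\<close>
      have "p' (r w) \<noteq> p (r w)"
      proof
        assume "p' (r w) = p (r w)"
        then have "r w = w" using pr permutes_inj[OF p'] by (simp add: inj_eq)
        then show False using False pr by simp
      qed
      then have "q' (r w) = p (r w)" using switch[of "r w"] by auto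
      then show ?thesis using pr w by simp
    qed
  qed
  have "sign p' = sign p * sign r"
    unfolding p'_eq by (rule sign_compose[OF perm[OF p] perm[OF r]])
  moreover have "sign q = sign q' * sign r"
    unfolding q_eq by (rule sign_compose[OF perm[OF q'] perm[OF r]])
  ultimately show ?thesis by (simp add: ac_simps)
qed

section \<open>Flows as permutations\<close>

lemma vwalk_arcs_conv_zip: "vwalk_arcs p = zip p (tl p)"
  by (induction p rule: vwalk_arcs.induct) auto

lemma in_vwalk_arcsE:
  assumes "(u, v) \<in> set (vwalk_arcs p)"
  obtains i where "Suc i < length p" "u = p ! i" "v = p ! Suc i"
proof -
  from assms obtain i where "i < length (tl p)" "u = p ! i" "v = tl p ! i"
    by (auto simp: vwalk_arcs_conv_zip set_zip)
  then show thesis using that[of i] by (simp add: nth_tl)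
qed

lemma distinct_vwalk_arcs: "distinct p \<Longrightarrow> distinct (vwalk_arcs p)"
  by (simp add: vwalk_arcs_conv_zip distinct_zipI1)

text \<open>By \<open>cyclic_rotation\<close> with exponent 1, mapping the cycle over its own list
  rotates the list by one place.\<close>

lemma cycle_of_list_nth:
  assumes "distinct p" and "i < length p"
  shows "cycle_of_list p (p ! i) = p ! (Suc i mod length p)"
  using cyclic_rotation[OF assms(1), of 1] assms(2)
  by (metis One_nat_def funpow.simps(1) funpow_Suc_right id_o nth_map nth_rotate1 rotate0 rotate_Suc id_apply)

lemma cycle_of_list_vwalk_arcs:
  assumes "distinct p" and "(u, v) \<in> set (vwalk_arcs p)"
  shows "cycle_of_list p u = v"
  using assms by (auto elim!: in_vwalk_arcsE simp: cycle_of_list_nth)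

lemma cycle_of_list_last:
  assumes "distinct p" and "p \<noteq> []"
  shows "cycle_of_list p (last p) = hd p"
  using assms cycle_of_list_nth[of p "length p - 1"] by (simp add: last_conv_nth hd_conv_nth)

lemma vwalk_arcs_into:
  assumes "v \<in> set p" and "v \<noteq> hd p"
  shows "v \<in> snd ` set (vwalk_arcs p)"
  using assms by (induction p rule: vwalk_arcs.induct) auto

lemma fst_snd_vwalk_arcs:
  assumes "(u, v) \<in> set (vwalk_arcs p)"
  shows "u \<in> set p" and "v \<in> set p"
  using assms by (auto elim!: in_vwalk_arcsE)

text \<open>Both sides list the vertices of the walk. For a closed walk this makes the heads a
  rotation of the tails.\<close>

lemma pcas_map_snd: "pcas u es v \<Longrightarrow> u # map snd es = map fst es @ [v]"
  by (induction es arbitrary: u) auto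

text \<open>The tails of the arcs list every vertex of the cycle once, and the heads are the same
  list rotated, so the cyclic permutation of the tails follows the arcs. Its sign is written with a
  minus in front because that minus supplies the factor -1 which each cycle contributes to
  \<open>flow_sign\<close>.\<close>

lemma self_avoiding_cycle_permutation:
  assumes "pair_digraph G" and "self_avoiding_cycle G c"
  obtains g where "g permutes Field c" and "\<And>u v. (u, v) \<in> c \<Longrightarrow> g u = v"
    and "sign g = - ((-1) ^ card c)" and "Field c \<subseteq> snd ` c" and "c \<subseteq> parcs G"
proof -
  interpret pair_digraph G by fact
  obtain u es where es: "c = set es" "es \<noteq> []" "awalk u es u" "distinct (tl (awalk_verts u es))"
    using assms(2) unfolding self_avoiding_cycle_def cycle_def by auto
  then have "pcas u es u" and arcs: "set es \<subseteq> parcs G" by (auto simp: awalk_def)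
  then have eq: "u # map snd es = map fst es @ [u]" by (simp add: pcas_map_snd)
  \<comment> \<open>The definition of a cycle makes the vertices after the first distinct; these are
    the heads, and the rotation carries distinctness over to the tails.\<close>
  have "tl (awalk_verts u es) = map snd es"
    using \<open>pcas u es u\<close> es(2) by (simp add: awalk_verts_conv')
  then have dist_snd: "distinct (map snd es)" using es by simp
  have rot: "rotate1 (map fst es) = map snd es"
    using eq es(2) by (cases es) auto
  then have dist: "distinct (map fst es)" using dist_snd by (metis distinct1_rotate)
  define g where "g = cycle_of_list (map fst es)"
  have fst_snd: "fst ` c = snd ` c"
    using rot es(1) by (metis set_map set_rotate1)
  have "map g (map fst es) = map snd es"
    using cyclic_rotation[OF dist, of 1] rot by (simp add: g_def)
  then have g: "g (fst e) = snd e" if "e \<in> set es" for e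
    using that by auto
  show thesis
  proof
    have "Field c = set (map fst es)"
      using fst_snd es(1) by (auto simp: Field_def Domain_fst Range_snd)
    then show "g permutes Field c" unfolding g_def by (metis cycle_permutes)
    show "g u = v" if "(u, v) \<in> c" for u v using g that es(1) by auto
    have "card c = length es" using dist es(1) by (simp add: distinct_card distinct_map)
    then show "sign g = - ((-1) ^ card c)"
      unfolding g_def using dist es(2) by (cases es) (simp_all add: sign_cycle_of_list)
    show "Field c \<subseteq> snd ` c" using fst_snd by (auto simp: Field_def Domain_fst Range_snd)
    show "c \<subseteq> parcs G" using arcs es(1) by simp
  qed
qed

text \<open>A plain set keeps all multiplicities of a flow: its paths and cycles are vertex-disjoint
  and repeat no vertex, so no arc is used twice.\<close>

definition flow_arcs :: "'v flow \<Rightarrow> ('v \<times> 'v) set" where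
  "flow_arcs F = (\<Union>p\<in>fst F. set (vwalk_arcs p)) \<union> \<Union>(snd F)"

section \<open>The arcs and end vertices of a single flow\<close>

locale flow_in_digraph =
  fixes G :: "'v pair_pre_digraph" and X Y :: "'v set" and P :: "'v list set"
    and C :: "('v \<times> 'v) set set"
  assumes G: "pair_digraph G" and flow: "self_avoiding_flow G X Y (P, C)"
begin

interpretation pair_digraph G by (fact G)

lemma finite_P: "finite P" and card_P: "card P = card X"
  and XV: "X \<subseteq> pverts G" and card_XY: "card X = card Y"
  and hd_P: "hd ` P = X" and last_P: "last ` P = Y"
  and disjnt_P: "pairwise (\<lambda>p q. disjnt (set p) (set q)) P"
  and disjnt_C: "pairwise (\<lambda>c d. disjnt (Field c) (Field d)) C"
  and disjnt_PC: "p \<in> P \<Longrightarrow> c \<in> C \<Longrightarrow> disjnt (set p) (Field c)"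
  and cycle_C: "c \<in> C \<Longrightarrow> self_avoiding_cycle G c"
  using flow by (auto simp: self_avoiding_flow_def)

lemma path:
  assumes "p \<in> P"
  shows "distinct p" and "p \<noteq> []" and "set p \<subseteq> pverts G" and "set (vwalk_arcs p) \<subseteq> parcs G"
  using flow assms by (auto simp: self_avoiding_flow_def self_avoiding_path_def vpath_def vwalk_def)

lemma cycle_arcs: "c \<in> C \<Longrightarrow> c \<subseteq> parcs G"
  using self_avoiding_cycle_permutation[OF G cycle_C] by blast

text \<open>Finiteness of the set of cycles comes from the graph: cycles are subsets of its finite
  arc set.\<close>

lemma finite_C: "finite C"
  using cycle_arcs pair_finite_arcs by (intro finite_subset[of C "Pow (parcs G)"]) auto

lemma finite_cycle: "c \<in> C \<Longrightarrow> finite c"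
  using cycle_arcs pair_finite_arcs by (rule finite_subset)

lemma Field_cycle: "c \<in> C \<Longrightarrow> Field c \<subseteq> pverts G"
  using cycle_arcs by (fastforce simp: Field_def dest: in_arcsD1 in_arcsD2)

lemma flow_arcs_subset: "flow_arcs (P, C) \<subseteq> parcs G"
  using cycle_arcs path(4) by (auto simp: flow_arcs_def)

lemma finite_flow_arcs: "finite (flow_arcs (P, C))"
  using flow_arcs_subset pair_finite_arcs by (rule finite_subset)

lemma disjoint_path_arcs:
  "\<forall>p\<in>P. \<forall>q\<in>P. p \<noteq> q \<longrightarrow> set (vwalk_arcs p) \<inter> set (vwalk_arcs q) = {}"
  using disjnt_P by (fastforce simp: pairwise_def disjnt_def dest: fst_snd_vwalk_arcs)

lemma disjoint_cycle_arcs: "\<forall>c\<in>C. \<forall>d\<in>C. c \<noteq> d \<longrightarrow> c \<inter> d = {}"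
  using disjnt_C by (fastforce simp: pairwise_def disjnt_def Field_def)

lemma disjoint_path_cycle_arcs: "(\<Union>p\<in>P. set (vwalk_arcs p)) \<inter> \<Union>C = {}"
  using disjnt_PC by (fastforce simp: disjnt_def Field_def dest: fst_snd_vwalk_arcs)

text \<open>Disjoint vertex sets give disjoint arc sets. Taking the indeterminates for
  \<open>f\<close> yields the monomial of the flow, and taking the constant -1 yields its
  sign.\<close>

lemma prod_flow_arcs:
  fixes f :: "'v \<times> 'v \<Rightarrow> 'c :: comm_monoid_mult"
  shows "(\<Prod>e\<in>flow_arcs (P, C). f e)
    = (\<Prod>p\<in>P. \<Prod>e\<in>set (vwalk_arcs p). f e) * (\<Prod>c\<in>C. \<Prod>e\<in>c. f e)"
proof -
  have "(\<Prod>e\<in>flow_arcs (P, C). f e)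
      = (\<Prod>e\<in>(\<Union>p\<in>P. set (vwalk_arcs p)). f e) * (\<Prod>e\<in>\<Union>C. f e)"
    unfolding flow_arcs_def fst_conv snd_conv
    using disjoint_path_cycle_arcs finite_P finite_C finite_cycle
    by (intro prod.union_disjoint) auto
  also have "(\<Prod>e\<in>(\<Union>p\<in>P. set (vwalk_arcs p)). f e)
      = (\<Prod>p\<in>P. \<Prod>e\<in>set (vwalk_arcs p). f e)"
    using finite_P disjoint_path_arcs by (intro prod.UNION_disjoint) auto
  also have "(\<Prod>e\<in>\<Union>C. f e) = (\<Prod>c\<in>C. \<Prod>e\<in>c. f e)"
    using finite_C finite_cycle disjoint_cycle_arcs
    by (subst prod.Union_disjoint) auto
  finally show ?thesis .
qed

lemma flow_monomial: "flow_monomial (P, C) = (\<Prod>e\<in>flow_arcs (P, C). edge_poly e)"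
  unfolding prod_flow_arcs flow_monomial_def fst_conv snd_conv
  by (intro arg_cong2[of _ _ _ _ "(*)"] prod.cong refl)
     (simp add: prod.distinct_set_conv_list distinct_vwalk_arcs path)

lemma inj_on_hd: "inj_on hd P"
  using finite_P card_P hd_P by (intro eq_card_imp_inj_on) auto

lemma inj_on_last: "inj_on last P"
  using finite_P card_P card_XY last_P by (intro eq_card_imp_inj_on) auto

text \<open>The definite description in \<open>flow_perm\<close> is well defined because only one
  path starts at \<open>xs ! i\<close> and \<open>ys\<close> has no repetition. Injectivity holds
  because only one path ends at a given vertex.\<close>

lemma flow_perm:
  assumes xs: "xs \<in> permutations_of_set X" and ys: "ys \<in> permutations_of_set Y"
  shows flow_perm_permutes: "flow_perm xs ys (P, C) permutes {..<length xs}"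
    and flow_perm_path: "i < length xs \<Longrightarrow> \<exists>p\<in>P. hd p = xs ! i \<and> last p = ys ! flow_perm xs ys (P, C) i"
proof -
  let ?f = "flow_perm xs ys (P, C)"
  have set: "set xs = X" "set ys = Y" "distinct xs" "distinct ys"
    using xs ys by (auto simp: permutations_of_set_def)
  have len: "length xs = length ys"
    using set card_XY by (metis distinct_card)
  have ex: "?f i < length ys \<and> (\<exists>p\<in>P. hd p = xs ! i \<and> last p = ys ! ?f i)"
    if "i < length xs" for i
  proof -
    have "xs ! i \<in> hd ` P" using that set hd_P by auto
    then obtain p where p: "p \<in> P" "hd p = xs ! i" by auto
    moreover have "last p \<in> set ys" using p set last_P by auto
    then obtain j where j: "j < length ys" "last p = ys ! j" by (metis in_set_conv_nth)
    have "(THE j. j < length ys \<and> (\<exists>p\<in>P. hd p = xs ! i \<and> last p = ys ! j)) = j"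
    proof (rule the_equality)
      show "j < length ys \<and> (\<exists>p\<in>P. hd p = xs ! i \<and> last p = ys ! j)" using p j by blast
    next
      fix j' assume j': "j' < length ys \<and> (\<exists>p\<in>P. hd p = xs ! i \<and> last p = ys ! j')"
      then obtain q where "q \<in> P" "hd q = xs ! i" "last q = ys ! j'" by blast
      then have "q = p" using inj_onD[OF inj_on_hd, of q p] p by simp
      then show "j' = j" using j j' \<open>last q = ys ! j'\<close> set(4) by (simp add: nth_eq_iff_index_eq)
    qed
    then show ?thesis using that p j by (auto simp: flow_perm_def)
  qed
  then show "i < length xs \<Longrightarrow> \<exists>p\<in>P. hd p = xs ! i \<and> last p = ys ! ?f i" by blast
  show "?f permutes {..<length xs}"
  proof (rule inj_imp_permutes)
    show "inj_on ?f {..<length xs}"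
    proof
      fix i j assume i: "i \<in> {..<length xs}" and j: "j \<in> {..<length xs}" and eq: "?f i = ?f j"
      obtain p q where "p \<in> P" "hd p = xs ! i" "last p = ys ! ?f i"
        and "q \<in> P" "hd q = xs ! j" "last q = ys ! ?f j"
        using ex i j by blast
      moreover from this eq have "p = q" using inj_onD[OF inj_on_last, of p q] by simp
      ultimately show "i = j" using set(3) i j by (simp add: nth_eq_iff_index_eq)
    qed
  qed (use ex len in \<open>auto simp: flow_perm_def\<close>)
qed

text \<open>
  Closing up each path turns the flow into a product of disjoint cyclic permutations; the starting
  points are then permuted so that \<open>ys ! i\<close> is sent to \<open>xs ! i\<close>.
\<close>
lemma successor_permutation:
  assumes xs: "xs \<in> permutations_of_set X" and ys: "ys \<in> permutations_of_set Y"
  obtains s where "s permutes pverts G"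
    and "\<And>u v. (u, v) \<in> flow_arcs (P, C) \<Longrightarrow> v \<notin> X \<Longrightarrow> s u = v"
    and "\<And>v. v \<notin> X \<Longrightarrow> v \<notin> snd ` flow_arcs (P, C) \<Longrightarrow> s v = v"
    and "\<And>i. i < length xs \<Longrightarrow> s (ys ! i) = xs ! i"
    and "sign s = flow_sign xs ys (P, C) * (-1) ^ card (flow_arcs (P, C))"
proof -
  have set: "set xs = X" "set ys = Y" "distinct xs" "distinct ys"
    using xs ys by (auto simp: permutations_of_set_def)
  have len: "length xs = length ys"
    using set card_XY by (metis distinct_card)
  let ?f = "flow_perm xs ys (P, C)" and ?n = "{..<length xs}"
  obtain g where g: "g permutes (\<Union>p\<in>P. set p)"
    "\<And>p v. p \<in> P \<Longrightarrow> v \<in> set p \<Longrightarrow> g v = cycle_of_list p v"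
    "sign g = (\<Prod>p\<in>P. sign (cycle_of_list p))"
    by (rule permutation_of_disjoint_family[OF finite_P _ _ disjnt_P, of cycle_of_list])
       (auto simp: cycle_permutes)
  have "\<forall>c\<in>C. \<exists>g. g permutes Field c \<and> (\<forall>u v. (u, v) \<in> c \<longrightarrow> g u = v)
      \<and> sign g = - ((-1) ^ card c) \<and> Field c \<subseteq> snd ` c" (is "\<forall>c\<in>C. \<exists>g. ?Q c g")
  proof
    fix c assume "c \<in> C"
    show "\<exists>g. ?Q c g"
      by (rule self_avoiding_cycle_permutation[OF G cycle_C[OF \<open>c \<in> C\<close>]]) blast
  qed
  from bchoice[OF this] obtain k where k: "\<And>c. c \<in> C \<Longrightarrow> k c permutes Field c"
    "\<And>c u v. c \<in> C \<Longrightarrow> (u, v) \<in> c \<Longrightarrow> k c u = v"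
    "\<And>c. c \<in> C \<Longrightarrow> sign (k c) = - ((-1) ^ card c)"
    "\<And>c. c \<in> C \<Longrightarrow> Field c \<subseteq> snd ` c"
    by blast
  have "finite (Field c)" if "c \<in> C" for c
    using finite_cycle[OF that] by (rule finite_Field)
  from permutation_of_disjoint_family[OF finite_C this k(1) disjnt_C]
  obtain h where h: "h permutes (\<Union>c\<in>C. Field c)"
    "\<And>c v. c \<in> C \<Longrightarrow> v \<in> Field c \<Longrightarrow> h v = k c v"
    "sign h = (\<Prod>c\<in>C. sign (k c))"
    by blast
  \<comment> \<open>Closing up the paths sends \<open>ys ! ?f j\<close> to \<open>xs ! j\<close>.
    Moving \<open>?f\<close> from indices to \<open>X\<close> gives the correction
    \<open>xs ! j\<close> to \<open>xs ! ?f j\<close>, after which \<open>ys ! i\<close> arrives at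
    \<open>xs ! i\<close>; the transport preserves the sign.\<close>
  define t where "t = map_permutation ?n ((!) xs) ?f"
  have bij: "bij_betw ((!) xs) ?n X"
    using set by (auto simp: bij_betw_def inj_on_nth set_conv_nth)
  have f: "?f permutes ?n" by (rule flow_perm_permutes[OF xs ys])
  have t: "t permutes X" unfolding t_def using bij f by (rule map_permutation_permutes)
  have t_nth: "t (xs ! i) = xs ! ?f i" if "i < length xs" for i
    unfolding t_def using bij that by (intro map_permutation_apply) (auto simp: bij_betw_def)
  have sign_t: "sign t = sign ?f"
    unfolding t_def using bij f by (intro sign_map_permutation) (auto simp: bij_betw_def)
  have gV: "g permutes pverts G" using path(3) by (intro permutes_subset[OF g(1)]) auto
  have hV: "h permutes pverts G" using Field_cycle by (intro permutes_subset[OF h(1)]) auto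
  have tV: "t permutes pverts G" using XV by (intro permutes_subset[OF t]) auto
  have off: "(\<Union>p\<in>P. set p) \<inter> (\<Union>c\<in>C. Field c) = {}"
    using disjnt_PC by (fastforce simp: disjnt_def)
  have hp: "h v = v" if "p \<in> P" "v \<in> set p" for p v
    using that off by (intro permutes_not_in[OF h(1)]) auto
  have gc: "g v = v" if "c \<in> C" "v \<in> Field c" for c v
    using that off by (intro permutes_not_in[OF g(1)]) auto
  let ?s = "t \<circ> (g \<circ> h)"
  show thesis
  proof
    show "?s permutes pverts G" by (intro permutes_compose gV hV tV)
    show "?s u = v" if uv: "(u, v) \<in> flow_arcs (P, C)" "v \<notin> X" for u v
    proof -
      have "g (h u) = v"
      proof (cases "(u, v) \<in> \<Union>C")
        case True
        then obtain c where c: "c \<in> C" "(u, v) \<in> c" by auto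
        then have "u \<in> Field c" "v \<in> Field c" by (auto simp: Field_def)
        then show ?thesis using c h(2) k(2) gc by auto
      next
        case False
        then obtain p where p: "p \<in> P" "(u, v) \<in> set (vwalk_arcs p)"
          using uv(1) by (auto simp: flow_arcs_def)
        then show ?thesis
          using fst_snd_vwalk_arcs[OF p(2)] hp g(2) path(1) cycle_of_list_vwalk_arcs by metis
      qed
      then show ?thesis using uv(2) permutes_not_in[OF t] by simp
    qed
    show "?s v = v" if "v \<notin> X" "v \<notin> snd ` flow_arcs (P, C)" for v
    proof -
      \<comment> \<open>A vertex on a path either starts it, and so lies in \<open>X\<close>, or has
        an incoming arc; a vertex on a cycle always has one. Hence \<open>v\<close> is off the
        flow.\<close>
      have "v \<notin> set p" if "p \<in> P" for p
        using that \<open>v \<notin> X\<close> \<open>v \<notin> snd ` flow_arcs (P, C)\<close> vwalk_arcs_into[of v p] hd_P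
        by (force simp: flow_arcs_def)
      moreover have "v \<notin> Field c" if "c \<in> C" for c
        using that \<open>v \<notin> snd ` flow_arcs (P, C)\<close> k(4)[OF that] by (force simp: flow_arcs_def)
      ultimately show ?thesis
        using permutes_not_in[OF t \<open>v \<notin> X\<close>] permutes_not_in[OF g(1)] permutes_not_in[OF h(1)]
        by auto
    qed
    show "?s (ys ! i) = xs ! i" if "i < length xs" for i
    proof -
      have "i \<in> ?f ` ?n" using permutes_image[OF f] that by simp
      then obtain j where j: "j < length xs" "?f j = i" by auto
      then obtain p where p: "p \<in> P" "hd p = xs ! j" "last p = ys ! i"
        using flow_perm_path[OF xs ys] by blast
      then have "last p \<in> set p" using path(2) last_in_set by blast
      then have "h (last p) = last p" and "g (last p) = hd p"
        using hp[OF p(1)] g(2)[OF p(1)] cycle_of_list_last[OF path(1,2)[OF p(1)]] by simp_all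
      then show ?thesis using p j t_nth by auto
    qed
    \<comment> \<open>A path has one arc fewer than vertices, so closing it up gives exactly -1 per
      arc. A cycle has as many arcs as vertices, which leaves one extra minus sign; together these
      form \<open>(-1) ^ card C\<close>.\<close>
    have "sign (cycle_of_list p) = (\<Prod>e\<in>set (vwalk_arcs p). - 1)" if "p \<in> P" for p
      using path(1,2)[OF that]
      by (simp add: sign_cycle_of_list distinct_card distinct_vwalk_arcs
          flip: vwalk_length_def)
    moreover have "sign (k c) = - (\<Prod>e\<in>c. - 1)" if "c \<in> C" for c
      using k(3) that by simp
    ultimately have "sign g * sign h
        = (\<Prod>p\<in>P. \<Prod>e\<in>set (vwalk_arcs p). - 1) * (\<Prod>c\<in>C. - (\<Prod>e\<in>c. - 1))"
      unfolding g(3) h(3) by (intro arg_cong2[of _ _ _ _ "(*)"] prod.cong refl) auto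
    also have "(\<Prod>c\<in>C. - (\<Prod>e\<in>c. - 1)) = (-1) ^ card C * (\<Prod>c\<in>C. \<Prod>e\<in>c. - 1 :: int)"
      by (rule prod_uminus)
    finally have "sign g * sign h = (-1) ^ card C * (-1) ^ card (flow_arcs (P, C))"
      using prod_flow_arcs[of "\<lambda>_. -1 :: int"] by simp
    moreover have "permutation p" if "p permutes pverts G" for p
      using permutes_imp_permutation[OF pair_finite_verts that] .
    ultimately show "sign ?s = flow_sign xs ys (P, C) * (-1) ^ card (flow_arcs (P, C))"
      using gV hV tV sign_t
      by (simp add: sign_compose permutation_compose flow_sign_def)
  qed
qed

text \<open>Inverting moves the exceptional vertices from \<open>Y\<close> to \<open>X\<close>. The
  tops are common to the left and right flow and visible in the monomial, whereas the end sets
  \<open>A\<close> and \<open>B\<close> may differ. The case \<open>u = v\<close> is left out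
  because \<open>p v = v\<close> is the default for a vertex without incoming arc.\<close>

lemma predecessor_permutation:
  assumes xs: "xs \<in> permutations_of_set X" and ys: "ys \<in> permutations_of_set Y"
  obtains p where "p permutes pverts G"
    and "\<And>u v. v \<notin> X \<Longrightarrow> u \<noteq> v \<Longrightarrow> p v = u \<longleftrightarrow> (u, v) \<in> flow_arcs (P, C)"
    and "\<And>i. i < length xs \<Longrightarrow> p (xs ! i) = ys ! i"
    and "sign p = flow_sign xs ys (P, C) * (-1) ^ card (flow_arcs (P, C))"
proof -
  obtain s where s: "s permutes pverts G"
    "\<And>u v. (u, v) \<in> flow_arcs (P, C) \<Longrightarrow> v \<notin> X \<Longrightarrow> s u = v"
    "\<And>v. v \<notin> X \<Longrightarrow> v \<notin> snd ` flow_arcs (P, C) \<Longrightarrow> s v = v"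
    "\<And>i. i < length xs \<Longrightarrow> s (ys ! i) = xs ! i"
    "sign s = flow_sign xs ys (P, C) * (-1) ^ card (flow_arcs (P, C))"
    using successor_permutation[OF xs ys] by blast
  note inv_eq = permutes_inv_eq[OF s(1)]
  show thesis
  proof
    show "inv s permutes pverts G" by (rule permutes_inv[OF s(1)])
    show "inv s (xs ! i) = ys ! i" if "i < length xs" for i
      using s(4)[OF that] by (simp add: inv_eq)
    show "sign (inv s) = flow_sign xs ys (P, C) * (-1) ^ card (flow_arcs (P, C))"
      using s(5) permutes_imp_permutation[OF pair_finite_verts s(1)] by (simp add: sign_inverse)
    show "inv s v = u \<longleftrightarrow> (u, v) \<in> flow_arcs (P, C)" if v: "v \<notin> X" "u \<noteq> v" for u v
    proof
      assume "inv s v = u"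
      then have su: "s u = v" by (simp add: inv_eq)
      \<comment> \<open>Injectivity rules out the default value at \<open>v\<close>, so
        \<open>v\<close> has an incoming arc; injectivity again identifies its tail with
        \<open>u\<close>.\<close>
      then have "s v \<noteq> v" using v(2) permutes_inj[OF s(1)] by (metis injD)
      then obtain u' where u': "(u', v) \<in> flow_arcs (P, C)" using s(3)[OF v(1)] by (force simp: image_iff)
      then have "s u' = s u" using s(2) v(1) su by simp
      then have "u' = u" using permutes_inj[OF s(1)] by (metis injD)
      then show "(u, v) \<in> flow_arcs (P, C)" using u' by simp
    next
      assume "(u, v) \<in> flow_arcs (P, C)"
      then show "inv s v = u" using s(2) v(1) by (simp add: inv_eq)
    qed
  qed
qed

end

section \<open>Monomials\<close>

lemma prod_indet_poly:
  assumes "finite I"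
  shows "(\<Prod>i\<in>I. indet_poly (f i))
    = Poly_Mapping.single (\<Sum>i\<in>I. Poly_Mapping.single (f i) 1) 1"
  using assms by (induction I rule: finite_induct) (simp_all add: indet_poly_def mult_single)

lemma lookup_sum_single:
  assumes "finite I" and "inj_on f I"
  shows "Poly_Mapping.lookup (\<Sum>i\<in>I. Poly_Mapping.single (f i) (1 :: nat)) x = of_bool (x \<in> f ` I)"
  using assms
  by (induction I rule: finite_induct)
     (auto simp: lookup_add lookup_single when_def)

text \<open>Both sides are single monomials with coefficient 1, so their exponent vectors agree. The
  exponent of \<open>Omega i\<close> records membership in the set of tops, and that of an arc says
  whether none, one or both of the two flows use it.\<close>

lemma trek_monomial_eqD:
  assumes fin: "finite S" "finite S'" "finite L" "finite R" "finite L'" "finite R'"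
    and eq: "(\<Prod>i\<in>S. indet_poly (Omega i)) * (\<Prod>e\<in>L. edge_poly e) * (\<Prod>e\<in>R. edge_poly e)
      = (\<Prod>i\<in>S'. indet_poly (Omega i)) * (\<Prod>e\<in>L'. edge_poly e) * (\<Prod>e\<in>R'. edge_poly e)"
  shows "S = S'"
    and "of_bool (e \<in> L) + of_bool (e \<in> R) = (of_bool (e \<in> L') + of_bool (e \<in> R') :: nat)"
proof -
  define arc where "arc e = Lambda (fst e) (snd e)" for e :: "'a \<times> 'a"
  have arc: "arc e \<in> arc ` E \<longleftrightarrow> e \<in> E" "inj_on arc E" "Omega i \<notin> arc ` E"
    "arc e \<notin> Omega ` V" "Omega i \<in> Omega ` V \<longleftrightarrow> i \<in> V" "inj_on Omega V"
    for e E and i :: 'a and V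
    by (auto simp: arc_def inj_on_def image_iff prod_eq_iff)
  define ex where "ex S L R = (\<Sum>i\<in>S. Poly_Mapping.single (Omega i) 1)
    + (\<Sum>e\<in>L. Poly_Mapping.single (arc e) 1) + (\<Sum>e\<in>R. Poly_Mapping.single (arc e) (1 :: nat))"
    for S :: "'a set" and L R
  have mon: "(\<Prod>i\<in>S. indet_poly (Omega i)) * (\<Prod>e\<in>L. edge_poly e) * (\<Prod>e\<in>R. edge_poly e)
      = Poly_Mapping.single (ex S L R) 1" if "finite S" "finite L" "finite R"
    for S :: "'a set" and L R
    using that by (simp add: edge_poly_def arc_def[symmetric] prod_indet_poly mult_single ex_def)
  have "ex S L R = ex S' L' R'"
    using eq fin unfolding mon[OF fin(1,3,4)] mon[OF fin(2,5,6)]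
    by (metis lookup_single_eq lookup_single_not_eq zero_neq_one)
  then have *: "Poly_Mapping.lookup (ex S L R) x = Poly_Mapping.lookup (ex S' L' R') x" for x
    by simp
  show "of_bool (e \<in> L) + of_bool (e \<in> R) = (of_bool (e \<in> L') + of_bool (e \<in> R') :: nat)"
    using *[of "arc e"] fin by (simp add: ex_def lookup_add lookup_sum_single[unfolded One_nat_def] arc)
  have "i \<in> S \<longleftrightarrow> i \<in> S'" for i
    using *[of "Omega i"] fin by (simp add: ex_def lookup_add lookup_sum_single[unfolded One_nat_def] arc of_bool_eq_iff)
  then show "S = S'" by blast
qed

text \<open>Sums over a common set \<open>U\<close> allow arc multiplicities to be added
  pointwise.\<close>

lemma card_eq_sum_of_bool:
  assumes "finite U" and "E \<subseteq> U"
  shows "card E = (\<Sum>e\<in>U. of_bool (e \<in> E))"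
  using assms by (simp add: of_bool_def sum.If_cases Int_absorb1)

text \<open>On each side the counts over all values add up to 2, so the count at the excluded
  \<open>w\<close> is determined by the others. The exclusion matters since no arc records the
  default value \<open>w\<close>.\<close>

lemma pair_eq_of_count:
  assumes "\<And>u. u \<noteq> w \<Longrightarrow> of_bool (a = u) + of_bool (b = u) = (of_bool (c = u) + of_bool (d = u) :: nat)"
  shows "(c = a \<and> d = b) \<or> (c = b \<and> d = a)"
  using assms[of a] assms[of b] assms[of c] assms[of d]
  by (cases "a = w"; cases "b = w"; cases "c = w"; cases "d = w"; cases "a = b"; cases "c = d";
      cases "a = c"; cases "a = d"; cases "b = c"; cases "b = d") simp_all

section \<open>Trek flows\<close>

theorem theorem3p9:
  fixes G :: "'v pair_pre_digraph"
    and A B :: "'v set" and k :: nat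
    and as bs ss ss' :: "'v list"
    and T T' :: "'v trek_flow"
  assumes "pair_digraph G"
    and "A \<subseteq> pverts G" and "B \<subseteq> pverts G"
    and "card A = k" and "card B = k"
    and "as \<in> permutations_of_set A" and "bs \<in> permutations_of_set B"
    and "self_avoiding_trek_flow G A B T" and "self_avoiding_trek_flow G A B T'"
    and "ss \<in> permutations_of_set (trek_tops T)"
    and "ss' \<in> permutations_of_set (trek_tops T')"
    and "trek_monomial T = trek_monomial T'"
  shows "trek_sign ss as bs T = trek_sign ss' as bs T'"
proof -
  interpret pair_digraph G by fact
  obtain PL CL PR CR where T: "T = ((PL, CL), (PR, CR))" by (metis surj_pair)
  obtain PL' CL' PR' CR' where T': "T' = ((PL', CL'), (PR', CR'))" by (metis surj_pair)
  obtain S where S: "self_avoiding_flow G S A (PL, CL)" "self_avoiding_flow G S B (PR, CR)"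
    using assms(8) by (auto simp: T self_avoiding_trek_flow_def)
  obtain S' where S': "self_avoiding_flow G S' A (PL', CL')" "self_avoiding_flow G S' B (PR', CR')"
    using assms(9) by (auto simp: T' self_avoiding_trek_flow_def)
  interpret L: flow_in_digraph G S A PL CL using assms(1) S(1) by unfold_locales
  interpret R: flow_in_digraph G S B PR CR using assms(1) S(2) by unfold_locales
  interpret L': flow_in_digraph G S' A PL' CL' using assms(1) S'(1) by unfold_locales
  interpret R': flow_in_digraph G S' B PR' CR' using assms(1) S'(2) by unfold_locales
  define EL ER EL' ER' where E_defs: "EL = flow_arcs (PL, CL)" "ER = flow_arcs (PR, CR)"
    "EL' = flow_arcs (PL', CL')" "ER' = flow_arcs (PR', CR')"
  have fin: "finite EL" "finite ER" "finite EL'" "finite ER'" "finite S" "finite S'"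
    using L.finite_flow_arcs R.finite_flow_arcs L'.finite_flow_arcs R'.finite_flow_arcs
      L.XV L'.XV pair_finite_verts by (auto simp: E_defs intro: finite_subset)
  have tops: "trek_tops T = S" "trek_tops T' = S'"
    using L.hd_P L'.hd_P by (auto simp: trek_tops_def T T')
  have eq: "(\<Prod>i\<in>S. indet_poly (Omega i)) * (\<Prod>e\<in>EL. edge_poly e) * (\<Prod>e\<in>ER. edge_poly e)
      = (\<Prod>i\<in>S'. indet_poly (Omega i)) * (\<Prod>e\<in>EL'. edge_poly e) * (\<Prod>e\<in>ER'. edge_poly e)"
    using assms(12) unfolding trek_monomial_def tops unfolding T T' fst_conv snd_conv
      L.flow_monomial R.flow_monomial L'.flow_monomial R'.flow_monomial E_defs .
  have "S = S'"
    using trek_monomial_eqD(1)[OF fin(5,6,1,2,3,4) eq] .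
  have count: "of_bool (e \<in> EL) + of_bool (e \<in> ER)
      = (of_bool (e \<in> EL') + of_bool (e \<in> ER') :: nat)" for e
    using trek_monomial_eqD(2)[OF fin(5,6,1,2,3,4) eq] .
  \<comment> \<open>Each predecessor permutation carries a factor -1 per arc of its flow. The total
    numbers of arcs agree because the multiplicities agree arc by arc.\<close>
  have "card E = (\<Sum>e\<in>parcs G. of_bool (e \<in> E))" if "E \<in> {EL, ER, EL', ER'}" for E
    using that L.flow_arcs_subset R.flow_arcs_subset L'.flow_arcs_subset R'.flow_arcs_subset
    by (intro card_eq_sum_of_bool[OF pair_finite_arcs]) (auto simp: E_defs)
  then have "card EL + card ER = (\<Sum>e\<in>parcs G. of_bool (e \<in> EL) + of_bool (e \<in> ER))"
    and "card EL' + card ER' = (\<Sum>e\<in>parcs G. of_bool (e \<in> EL') + of_bool (e \<in> ER'))"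
    by (simp_all add: sum.distrib del: sum_of_bool_eq)
  then have card: "card EL + card ER = card EL' + card ER'"
    by (simp only: count)
  have ss: "ss \<in> permutations_of_set S" and ss': "ss' \<in> permutations_of_set S'"
    using assms(10,11) by (simp_all add: tops)
  obtain pL where pL: "pL permutes pverts G"
    "\<And>u v. v \<notin> S \<Longrightarrow> u \<noteq> v \<Longrightarrow> pL v = u \<longleftrightarrow> (u, v) \<in> EL"
    "\<And>i. i < length ss \<Longrightarrow> pL (ss ! i) = as ! i"
    "sign pL = flow_sign ss as (PL, CL) * (-1) ^ card EL"
    unfolding E_defs using L.predecessor_permutation[OF ss assms(6)] by blast
  obtain pR where pR: "pR permutes pverts G"
    "\<And>u v. v \<notin> S \<Longrightarrow> u \<noteq> v \<Longrightarrow> pR v = u \<longleftrightarrow> (u, v) \<in> ER"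
    "\<And>i. i < length ss \<Longrightarrow> pR (ss ! i) = bs ! i"
    "sign pR = flow_sign ss bs (PR, CR) * (-1) ^ card ER"
    unfolding E_defs using R.predecessor_permutation[OF ss assms(7)] by blast
  obtain pL' where pL': "pL' permutes pverts G"
    "\<And>u v. v \<notin> S' \<Longrightarrow> u \<noteq> v \<Longrightarrow> pL' v = u \<longleftrightarrow> (u, v) \<in> EL'"
    "\<And>i. i < length ss' \<Longrightarrow> pL' (ss' ! i) = as ! i"
    "sign pL' = flow_sign ss' as (PL', CL') * (-1) ^ card EL'"
    unfolding E_defs using L'.predecessor_permutation[OF ss' assms(6)] by blast
  obtain pR' where pR': "pR' permutes pverts G"
    "\<And>u v. v \<notin> S' \<Longrightarrow> u \<noteq> v \<Longrightarrow> pR' v = u \<longleftrightarrow> (u, v) \<in> ER'"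
    "\<And>i. i < length ss' \<Longrightarrow> pR' (ss' ! i) = bs ! i"
    "sign pR' = flow_sign ss' bs (PR', CR') * (-1) ^ card ER'"
    unfolding E_defs using R'.predecessor_permutation[OF ss' assms(7)] by blast
  have set: "set ss = S" "set ss' = S" "distinct ss" "distinct ss'"
    using ss ss' \<open>S = S'\<close> by (auto simp: permutations_of_set_def)
  then have "mset ss = mset ss'" by (metis set_eq_iff_mset_eq_distinct)
  then have len: "length ss = length ss'" by (rule mset_eq_length)
  \<comment> \<open>The tops may be ordered differently for \<open>T\<close> and \<open>T'\<close>.
    The vertex permutation \<open>r\<close> takes \<open>ss' ! i\<close> to \<open>ss ! i\<close>;
    composing both \<open>pL\<close> and \<open>pR\<close> with it adapts them to
    \<open>ss'\<close>, and its sign enters twice and cancels.\<close>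
  obtain f where f: "f permutes {..<length ss'}" "permute_list f ss' = ss"
    using mset_eq_permutation[OF \<open>mset ss = mset ss'\<close>] .
  define r where "r = map_permutation {..<length ss'} ((!) ss') f"
  have bij: "bij_betw ((!) ss') {..<length ss'} S"
    using set by (auto simp: bij_betw_def inj_on_nth set_conv_nth)
  have r: "r permutes S" unfolding r_def using bij f(1) by (rule map_permutation_permutes)
  have r_nth: "r (ss' ! i) = ss ! i" if "i < length ss'" for i
    using bij that permute_list_nth[OF f(1) that] f(2)
    by (simp add: r_def map_permutation_apply bij_betw_def)
  have rV: "r permutes pverts G" using r L.XV by (rule permutes_subset)
  have "sign pL' * sign pR' = sign (pL \<circ> r) * sign (pR \<circ> r)"
  proof (rule sign_mult_eq_of_switch[OF pair_finite_verts])
    fix w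
    show "(pL' w = (pL \<circ> r) w \<and> pR' w = (pR \<circ> r) w)
      \<or> (pL' w = (pR \<circ> r) w \<and> pR' w = (pL \<circ> r) w)"
    proof (cases "w \<in> S")
      case True
      then obtain i where "i < length ss'" "w = ss' ! i" using set(2) by (metis in_set_conv_nth)
      \<comment> \<open>At a top no switch occurs: both left permutations give \<open>as ! i\<close>
        and both right ones give \<open>bs ! i\<close>.\<close>
      then show ?thesis using pL(3) pR(3) pL'(3) pR'(3) r_nth len by simp
    next
      case False
      then have "of_bool (pL w = u) + of_bool (pR w = u)
          = (of_bool (pL' w = u) + of_bool (pR' w = u) :: nat)" if "u \<noteq> w" for u
        using count[of "(u, w)"] pL(2) pR(2) pL'(2) pR'(2) that \<open>S = S'\<close> by simp
      then show ?thesis using pair_eq_of_count[of w "pL w" "pR w" "pL' w" "pR' w"]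
          permutes_not_in[OF r False] by simp
    qed
  qed (intro permutes_compose pL(1) pR(1) pL'(1) pR'(1) rV)+
  also have "\<dots> = sign pL * sign pR"
  proof -
    have "permutation p" if "p permutes pverts G" for p
      using permutes_imp_permutation[OF pair_finite_verts that] .
    then show ?thesis using pL(1) pR(1) rV by (simp add: sign_compose ac_simps)
  qed
  finally have "trek_sign ss' as bs T' * (-1) ^ (card EL' + card ER')
      = trek_sign ss as bs T * (-1) ^ (card EL + card ER)"
    by (simp add: trek_sign_def T T' pL(4) pR(4) pL'(4) pR'(4) power_add ac_simps)
  then show ?thesis by (simp add: card)
qed

end
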